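(* Let $V_0,\ldots,V_3\colon\mathbb{R}^3\to\mathbb{C}_{\mathbf{e}_4}$, let $v_i$ be the inverse octonion Fourier transform of $V_i$, $i=0,\ldots,3$, let $U_{\mathrm{OFT}}=V_0+V_1\mathbf{e}_1+V_2\mathbf{e}_2+V_3\mathbf{e}_1\mathbf{e}_2$ and let $u$ be the inverse octonion Fourier transform of $U_{\mathrm{OFT}}$. Then for all $(x_1,x_2,x_3)\in\mathbb{R}^3$ $$\begin{aligned}u(x_1,x_2,x_3)&=v_0(x_1,x_2,x_3)+v_1(x_1,-x_2,-x_3)\cdot\mathbf{e}_1\\&\quad+v_2(-x_1,x_2,-x_3)\cdot\mathbf{e}_2+v_3(-x_1,-x_2,x_3)\cdot\mathbf{e}_1\cdot\mathbf{e}_2.\end{aligned}$$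
   Context: $\mathbb{O}$ denotes the real algebra of octonions with basis $1,\mathbf{e}_1,\dots,\mathbf{e}_7$: an octonion is a pair $(q_0,q_1)$ of quaternions (quaternion units $\mathbf{e}_1,\mathbf{e}_2,\mathbf{e}_3$ with $\mathbf{e}_1\mathbf{e}_2=\mathbf{e}_3$), with product $(q_0,q_1)\cdot(p_0,p_1)=(q_0p_0-p_1^*q_1,\;p_1q_0+q_1p_0^* )$, where $^*$ is quaternion conjugation, and $\mathbf{e}_4=(0,1)$, $\mathbf{e}_5=(0,\mathbf{e}_1)$, $\mathbf{e}_6=(0,\mathbf{e}_2)$, $\mathbf{e}_7=(0,\mathbf{e}_3)$. The product is neither commutative nor associative; products without brackets are evaluated from left to right, i.e. $abcd=((ab)c)d$. For an imaginary unit $\mathbf{e}_k$ and $\alpha\in\mathbb{R}$, $e^{\mathbf{e}_k\alpha}=\cos\alpha+\mathbf{e}_k\sin\alpha$. Integrals of octonion-valued functions are taken componentwise. $\mathbb{C}_{\mathbf{e}_4}=\{a+b\mathbf{e}_4: a,b\in\mathbb{R}\}\subset\mathbb{O}$. The inverse octonion Fourier transform of a function $W\colon\mathbb{R}^3\to\mathbb{O}$ is $$w(\mathbf{x})=\int_{\mathbb{R}^3}W(\mathbf{f})\,e^{\mathbf{e}_4 2\pi f_3x_3}\,e^{\mathbf{e}_2 2\pi f_2x_2}\,e^{\mathbf{e}_1 2\pi f_1x_1}\,d\mathbf{f},$$ with multiplication from left to right. Standing assumption: $V_0,\dots,V_3$ are Lebesgue integrable, so that the inverse transforms are well defined. *)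

theory Defs
  imports "HOL-Analysis.Analysis"
begin

datatype quat = Quat (qRe: real) (qIm1: real) (qIm2: real) (qIm3: real)

lemma quat_eq_iff:
  "p = q \<longleftrightarrow> qRe p = qRe q \<and> qIm1 p = qIm1 q \<and> qIm2 p = qIm2 q \<and> qIm3 p = qIm3 q"
  by (cases p; cases q) simp

instantiation quat :: real_algebra_1
begin

definition zero_quat_def: "0 = Quat 0 0 0 0"
definition one_quat_def: "1 = Quat 1 0 0 0"
definition plus_quat_def:
  "p + q = Quat (qRe p + qRe q) (qIm1 p + qIm1 q) (qIm2 p + qIm2 q) (qIm3 p + qIm3 q)"
definition minus_quat_def:
  "p - q = Quat (qRe p - qRe q) (qIm1 p - qIm1 q) (qIm2 p - qIm2 q) (qIm3 p - qIm3 q)"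
definition uminus_quat_def:
  "- p = Quat (- qRe p) (- qIm1 p) (- qIm2 p) (- qIm3 p)"
definition scaleR_quat_def:
  "r *\<^sub>R p = Quat (r * qRe p) (r * qIm1 p) (r * qIm2 p) (r * qIm3 p)"
definition times_quat_def:
  "p * q = Quat
     (qRe p * qRe q - qIm1 p * qIm1 q - qIm2 p * qIm2 q - qIm3 p * qIm3 q)
     (qRe p * qIm1 q + qIm1 p * qRe q + qIm2 p * qIm3 q - qIm3 p * qIm2 q)
     (qRe p * qIm2 q - qIm1 p * qIm3 q + qIm2 p * qRe q + qIm3 p * qIm1 q)
     (qRe p * qIm3 q + qIm1 p * qIm2 q - qIm2 p * qIm1 q + qIm3 p * qRe q)"

lemmas quat_defs =
  zero_quat_def one_quat_def plus_quat_def minus_quat_def uminus_quat_def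
  scaleR_quat_def times_quat_def

instance
  by standard (simp_all add: quat_defs quat_eq_iff algebra_simps)

end

definition qcnj :: "quat \<Rightarrow> quat" where
  "qcnj q = Quat (qRe q) (- qIm1 q) (- qIm2 q) (- qIm3 q)"

datatype octonion = Oct (oFst: quat) (oSnd: quat)

lemma octonion_eq_iff: "a = b \<longleftrightarrow> oFst a = oFst b \<and> oSnd a = oSnd b"
  by (cases a; cases b) simp

instantiation octonion :: "{real_vector, one, times}"
begin

definition zero_octonion_def: "0 = Oct 0 0"
definition one_octonion_def: "1 = Oct 1 0"
definition plus_octonion_def: "a + b = Oct (oFst a + oFst b) (oSnd a + oSnd b)"
definition minus_octonion_def: "a - b = Oct (oFst a - oFst b) (oSnd a - oSnd b)"
definition uminus_octonion_def: "- a = Oct (- oFst a) (- oSnd a)"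
definition scaleR_octonion_def: "r *\<^sub>R a = Oct (r *\<^sub>R oFst a) (r *\<^sub>R oSnd a)"
definition times_octonion_def:
  "a * b = Oct (oFst a * oFst b - qcnj (oSnd b) * oSnd a)
               (oSnd b * oFst a + oSnd a * qcnj (oFst b))"

lemmas octonion_defs =
  zero_octonion_def one_octonion_def plus_octonion_def minus_octonion_def
  uminus_octonion_def scaleR_octonion_def times_octonion_def

instance
  by standard (simp_all add: octonion_defs octonion_eq_iff algebra_simps)

end

definition oct_e1 :: octonion  ("\<e>\<^sub>1") where "\<e>\<^sub>1 = Oct (Quat 0 1 0 0) 0"
definition oct_e2 :: octonion  ("\<e>\<^sub>2") where "\<e>\<^sub>2 = Oct (Quat 0 0 1 0) 0"
definition oct_e4 :: octonion  ("\<e>\<^sub>4") where "\<e>\<^sub>4 = Oct 0 1"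

definition C_e4 :: "octonion set" where
  "C_e4 = {a *\<^sub>R 1 + b *\<^sub>R \<e>\<^sub>4 | a b. True}"

text \<open>Euler form of \<open>exp (\<alpha> \<mu>)\<close>, meaningful for an imaginary unit \<open>\<mu>\<close> (\<open>\<mu> * \<mu> = -1\<close>).\<close>

definition oct_expi :: "octonion \<Rightarrow> real \<Rightarrow> octonion" where
  "oct_expi \<mu> \<alpha> = cos \<alpha> *\<^sub>R 1 + sin \<alpha> *\<^sub>R \<mu>"

definition quat_integrable :: "'a measure \<Rightarrow> ('a \<Rightarrow> quat) \<Rightarrow> bool" where
  "quat_integrable M f \<longleftrightarrow>
     integrable M (\<lambda>x. qRe (f x)) \<and> integrable M (\<lambda>x. qIm1 (f x)) \<and>
     integrable M (\<lambda>x. qIm2 (f x)) \<and> integrable M (\<lambda>x. qIm3 (f x))"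

definition oct_integrable :: "'a measure \<Rightarrow> ('a \<Rightarrow> octonion) \<Rightarrow> bool" where
  "oct_integrable M f \<longleftrightarrow>
     quat_integrable M (\<lambda>x. oFst (f x)) \<and> quat_integrable M (\<lambda>x. oSnd (f x))"

definition quat_integral :: "'a measure \<Rightarrow> ('a \<Rightarrow> quat) \<Rightarrow> quat" where
  "quat_integral M f = Quat (LINT x|M. qRe (f x)) (LINT x|M. qIm1 (f x))
                            (LINT x|M. qIm2 (f x)) (LINT x|M. qIm3 (f x))"

definition oct_integral :: "'a measure \<Rightarrow> ('a \<Rightarrow> octonion) \<Rightarrow> octonion" where
  "oct_integral M f =
     Oct (quat_integral M (\<lambda>x. oFst (f x))) (quat_integral M (\<lambda>x. oSnd (f x)))"

text \<open>Octonion multiplication is not associative; since \<open>*\<close> is left-associative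
  syntax, unbracketed products are evaluated from left to right.\<close>

definition inverse_oft :: "(real^3 \<Rightarrow> octonion) \<Rightarrow> real^3 \<Rightarrow> octonion" where
  "inverse_oft W x = oct_integral lebesgue (\<lambda>f.
     W f * oct_expi \<e>\<^sub>4 (2 * pi * f$3 * x$3)
         * oct_expi \<e>\<^sub>2 (2 * pi * f$2 * x$2)
         * oct_expi \<e>\<^sub>1 (2 * pi * f$1 * x$1))"

end

theory Submission
  imports Defs
begin

text \<open>
  The octonions are not associative, but they are alternative. Linearising the right alternative
  law gives \<open>(x a) b + (x b) a = x (a b + b a)\<close> for all octonions, so right multiplications by two
  anticommuting units anticommute as operators. Hence a right factor \<open>\<e>\<^sub>1\<close> can be moved
  from the left of the kernel \<open>exp (\<e>\<^sub>4 \<gamma>) exp (\<e>\<^sub>2 \<beta>) exp (\<e>\<^sub>1 \<alpha>)\<close> to its right: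
  it reverses the sign of the phases \<open>\<gamma>\<close> and \<open>\<beta>\<close>, whose units anticommute with \<open>\<e>\<^sub>1\<close>,
  and leaves \<open>\<alpha>\<close> alone. Likewise \<open>\<e>\<^sub>2\<close> reverses \<open>\<gamma>\<close> and \<open>\<alpha>\<close>. Reversing a phase
  is the same as reversing the corresponding coordinate of \<open>x\<close>
  (lemmas \<open>inverse_oft_mult_e1\<close> and \<open>inverse_oft_mult_e2\<close>).
  The term with \<open>\<e>\<^sub>1 \<e>\<^sub>2\<close> is handled by applying both rules: its bracketing from left
  to right means that only successive right multiplications ever occur, and the two reversals of
  \<open>\<gamma>\<close> cancel. The theorem then follows since the transform is additive on integrable functions.
\<close>

lemmas octonion_component_defs = octonion_defs octonion_eq_iff quat_defs quat_eq_iff qcnj_def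

lemma octonion_distrib_right: "(a + b) * c = a * c + b * c" for a b c :: octonion
  by (simp add: octonion_component_defs algebra_simps)

lemma octonion_distrib_left: "a * (b + c) = a * b + a * c" for a b c :: octonion
  by (simp add: octonion_component_defs algebra_simps)

lemma octonion_scaleR_left: "(r *\<^sub>R a) * b = r *\<^sub>R (a * b)" for a b :: octonion
  by (simp add: octonion_component_defs algebra_simps)

lemma octonion_scaleR_right: "a * (r *\<^sub>R b) = r *\<^sub>R (a * b)" for a b :: octonion
  by (simp add: octonion_component_defs algebra_simps)

lemma octonion_mult_1_right: "a * 1 = a" for a :: octonion
  by (simp add: octonion_component_defs)

lemma octonion_mult_0_right: "a * 0 = 0" for a :: octonion
  by (simp add: octonion_component_defs)

lemma octonion_right_alternative_linearised:
  "x * a * b + x * b * a = x * (a * b + b * a)" for x a b :: octonion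
  by (simp add: octonion_component_defs algebra_simps)

lemma mult_oct_expi: "x * oct_expi \<mu> t = cos t *\<^sub>R x + sin t *\<^sub>R (x * \<mu>)"
  by (simp add: oct_expi_def octonion_distrib_left octonion_scaleR_right octonion_mult_1_right)

text \<open>The case \<open>x = 1\<close> is the familiar \<open>a exp (b t) = exp (- b t) a\<close>; the linearised alternative
  law makes it hold behind an arbitrary left factor, where associativity is not available.\<close>

lemma oct_expi_anticommuting:
  assumes "a * b + b * a = 0"
  shows "x * a * oct_expi b t = x * oct_expi b (- t) * a"
proof -
  have "x * a * b + x * b * a = 0"
    by (simp only: octonion_right_alternative_linearised assms octonion_mult_0_right)
  then have "x * a * b = - (x * b * a)"
    by (rule eq_neg_iff_add_eq_0[THEN iffD2])
  then show ?thesis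
    by (simp add: mult_oct_expi octonion_distrib_right octonion_scaleR_left flip: scaleR_minus_left)
qed

lemma oct_expi_commuting: "x * a * oct_expi a t = x * oct_expi a t * a"
  by (simp add: mult_oct_expi octonion_distrib_right octonion_scaleR_left)

lemma e1_e2_anticommute: "\<e>\<^sub>1 * \<e>\<^sub>2 + \<e>\<^sub>2 * \<e>\<^sub>1 = 0"
  and e2_e1_anticommute: "\<e>\<^sub>2 * \<e>\<^sub>1 + \<e>\<^sub>1 * \<e>\<^sub>2 = 0"
  and e1_e4_anticommute: "\<e>\<^sub>1 * \<e>\<^sub>4 + \<e>\<^sub>4 * \<e>\<^sub>1 = 0"
  and e2_e4_anticommute: "\<e>\<^sub>2 * \<e>\<^sub>4 + \<e>\<^sub>4 * \<e>\<^sub>2 = 0"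
  by (simp_all add: oct_e1_def oct_e2_def oct_e4_def octonion_component_defs)

lemmas oct_integral_component_defs = oct_integrable_def quat_integrable_def
  oct_integral_def quat_integral_def

lemma oct_integrable_add:
  assumes "oct_integrable M f" "oct_integrable M g"
  shows "oct_integrable M (\<lambda>x. f x + g x)"
  using assms by (simp add: oct_integral_component_defs octonion_defs quat_defs)

lemma oct_integral_add:
  assumes "oct_integrable M f" "oct_integrable M g"
  shows "oct_integral M (\<lambda>x. f x + g x) = oct_integral M f + oct_integral M g"
  using assms by (simp add: oct_integral_component_defs octonion_defs quat_defs)

lemma oct_integrable_mult_left:
  assumes "oct_integrable M f"
  shows "oct_integrable M (\<lambda>x. f x * c)"
  using assms by (simp add: oct_integral_component_defs octonion_defs quat_defs qcnj_def)

lemma oct_integral_mult_left: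
  assumes "oct_integrable M f"
  shows "oct_integral M (\<lambda>x. f x * c) = oct_integral M f * c"
  using assms
  by (simp add: oct_integral_component_defs octonion_component_defs algebra_simps)

lemma integrable_bounded_mult:
  fixes f g :: "'a \<Rightarrow> real"
  assumes f: "integrable M f" and g: "g \<in> borel_measurable M" and bound: "\<And>x. \<bar>g x\<bar> \<le> 1"
  shows "integrable M (\<lambda>x. g x * f x)"
proof (rule Bochner_Integration.integrable_bound[OF f])
  show "(\<lambda>x. g x * f x) \<in> borel_measurable M"
    using f g by measurable
  show "AE x in M. norm (g x * f x) \<le> norm (f x)"
    by (intro AE_I2) (simp add: abs_mult bound mult_left_le_one_le)
qed

lemma oct_integrable_bounded_scaleR:
  assumes "oct_integrable M f" "g \<in> borel_measurable M" "\<And>x. \<bar>g x\<bar> \<le> 1"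
  shows "oct_integrable M (\<lambda>x. g x *\<^sub>R f x)"
  using assms
  by (simp add: oct_integral_component_defs octonion_defs quat_defs integrable_bounded_mult)

lemma oct_integrable_mult_oct_expi:
  assumes "oct_integrable M f" "\<theta> \<in> borel_measurable M"
  shows "oct_integrable M (\<lambda>x. f x * oct_expi \<mu> (\<theta> x))"
  unfolding mult_oct_expi
  using assms
  by (intro oct_integrable_add oct_integrable_bounded_scaleR oct_integrable_mult_left) simp_all

lemma borel_measurable_phase:
  "(\<lambda>f::real^3. 2 * pi * f $ i * c) \<in> borel_measurable lebesgue"
proof (rule measurable_completion)
  show "(\<lambda>f::real^3. 2 * pi * f $ i * c) \<in> borel_measurable lborel"
    by (simp add: borel_measurable_continuous_onI continuous_intros)
qed

lemma oct_integrable_inverse_oft_integrand: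
  fixes W :: "real^3 \<Rightarrow> octonion"
  assumes "oct_integrable lebesgue W"
  shows "oct_integrable lebesgue (\<lambda>f. W f * oct_expi \<e>\<^sub>4 (2 * pi * f$3 * x$3)
    * oct_expi \<e>\<^sub>2 (2 * pi * f$2 * x$2) * oct_expi \<e>\<^sub>1 (2 * pi * f$1 * x$1))"
  using assms by (intro oct_integrable_mult_oct_expi borel_measurable_phase)

lemma inverse_oft_add:
  assumes "oct_integrable lebesgue V" "oct_integrable lebesgue W"
  shows "inverse_oft (\<lambda>f. V f + W f) x = inverse_oft V x + inverse_oft W x"
  unfolding inverse_oft_def octonion_distrib_right
  using assms by (intro oct_integral_add oct_integrable_inverse_oft_integrand)

lemma inverse_oft_mult_e1:
  assumes "oct_integrable lebesgue V"
  shows "inverse_oft (\<lambda>f. V f * \<e>\<^sub>1) (vector [x1, x2, x3])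
    = inverse_oft V (vector [x1, - x2, - x3]) * \<e>\<^sub>1"
proof -
  have "V f * \<e>\<^sub>1 * oct_expi \<e>\<^sub>4 \<gamma> * oct_expi \<e>\<^sub>2 \<beta> * oct_expi \<e>\<^sub>1 \<alpha>
    = V f * oct_expi \<e>\<^sub>4 (- \<gamma>) * oct_expi \<e>\<^sub>2 (- \<beta>) * oct_expi \<e>\<^sub>1 \<alpha> * \<e>\<^sub>1" for f \<alpha> \<beta> \<gamma>
    by (simp only: oct_expi_anticommuting[OF e1_e4_anticommute]
        oct_expi_anticommuting[OF e1_e2_anticommute] oct_expi_commuting)
  then show ?thesis
    using oct_integral_mult_left[OF oct_integrable_inverse_oft_integrand[OF assms],
        of "vector [x1, - x2, - x3] :: real^3" "\<e>\<^sub>1"]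
    by (simp add: inverse_oft_def)
qed

lemma inverse_oft_mult_e2:
  assumes "oct_integrable lebesgue V"
  shows "inverse_oft (\<lambda>f. V f * \<e>\<^sub>2) (vector [x1, x2, x3])
    = inverse_oft V (vector [- x1, x2, - x3]) * \<e>\<^sub>2"
proof -
  have "V f * \<e>\<^sub>2 * oct_expi \<e>\<^sub>4 \<gamma> * oct_expi \<e>\<^sub>2 \<beta> * oct_expi \<e>\<^sub>1 \<alpha>
    = V f * oct_expi \<e>\<^sub>4 (- \<gamma>) * oct_expi \<e>\<^sub>2 \<beta> * oct_expi \<e>\<^sub>1 (- \<alpha>) * \<e>\<^sub>2" for f \<alpha> \<beta> \<gamma>
    by (simp only: oct_expi_anticommuting[OF e2_e4_anticommute]
        oct_expi_anticommuting[OF e2_e1_anticommute] oct_expi_commuting)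
  then show ?thesis
    using oct_integral_mult_left[OF oct_integrable_inverse_oft_integrand[OF assms],
        of "vector [- x1, x2, - x3] :: real^3" "\<e>\<^sub>2"]
    by (simp add: inverse_oft_def)
qed

theorem corollary2:
  fixes V0 V1 V2 V3 v0 v1 v2 v3 U_OFT u :: "real^3 \<Rightarrow> octonion"
  assumes "\<And>f. V0 f \<in> C_e4" and "\<And>f. V1 f \<in> C_e4"
    and "\<And>f. V2 f \<in> C_e4" and "\<And>f. V3 f \<in> C_e4"
    and "oct_integrable lebesgue V0" and "oct_integrable lebesgue V1"
    and "oct_integrable lebesgue V2" and "oct_integrable lebesgue V3"
    and "v0 = inverse_oft V0" and "v1 = inverse_oft V1"
    and "v2 = inverse_oft V2" and "v3 = inverse_oft V3"
    and "U_OFT = (\<lambda>f. V0 f + V1 f * \<e>\<^sub>1 + V2 f * \<e>\<^sub>2 + V3 f * \<e>\<^sub>1 * \<e>\<^sub>2)"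
    and "u = inverse_oft U_OFT"
  shows "\<forall>x1 x2 x3 :: real.
    u (vector [x1, x2, x3]) =
      v0 (vector [x1, x2, x3])
      + v1 (vector [x1, - x2, - x3]) * \<e>\<^sub>1
      + v2 (vector [- x1, x2, - x3]) * \<e>\<^sub>2
      + v3 (vector [- x1, - x2, x3]) * \<e>\<^sub>1 * \<e>\<^sub>2"
proof (intro allI)
  fix x1 x2 x3 :: real
  let ?x = "vector [x1, x2, x3] :: real^3"
  note integrable = assms(5-8)
  have "u ?x = inverse_oft V0 ?x + inverse_oft (\<lambda>f. V1 f * \<e>\<^sub>1) ?x
      + inverse_oft (\<lambda>f. V2 f * \<e>\<^sub>2) ?x + inverse_oft (\<lambda>f. V3 f * \<e>\<^sub>1 * \<e>\<^sub>2) ?x"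
    by (simp add: assms(13,14) inverse_oft_add oct_integrable_add oct_integrable_mult_left integrable)
  then show "u ?x = v0 ?x + v1 (vector [x1, - x2, - x3]) * \<e>\<^sub>1
      + v2 (vector [- x1, x2, - x3]) * \<e>\<^sub>2 + v3 (vector [- x1, - x2, x3]) * \<e>\<^sub>1 * \<e>\<^sub>2"
    by (simp add: assms(9-12) inverse_oft_mult_e1 inverse_oft_mult_e2
        oct_integrable_mult_left integrable)
qed

end
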